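(* Let $n\ge 2$, let $\Omega_1,\ldots,\Omega_n$ be closed subsets of a Banach space $X$, $\bar x\in\bigcap_{i=1}^n\Omega_i$, $a_i\in X$ $(i=1,\ldots,n)$, $\varepsilon>0$, $\rho\in\,]0,+\infty]$ and $\varphi\in\mathcal{C}$. Suppose that $$\bigcap_{i=1}^{n}(\Omega_i-a_i)\cap\mathbb{B}_\rho(\bar x)=\emptyset.$$ Then, for any $\lambda>0$ and any $\eta\in\,]0,\rho[$ such that $$\varphi\Big(\max_{1\le i\le n}\|a_i\|\Big)<\varphi\big(d(\Omega_1-a_1,\ldots,\Omega_n-a_n,\mathbb{B}_\eta(\bar x))\big)+\varepsilon,$$ there exist points $\omega_i\in\Omega_i\cap\mathbb{B}_\lambda(\bar x)$ $(i=1,\ldots,n)$ and $x\in\mathbb{B}_\eta(\bar x)$ such that $$\sup_{\substack{u_i\in\Omega_i\,(i=1,\ldots,n),\,u\in\mathbb{B}_\eta(\bar x)\\(u_1,\ldots,u_n,u)\ne(\omega_1,\ldots,\omega_n,x)}}\frac{\varphi\Big(\max\limits_{1\le i\le n}\|x+a_i-\omega_i\|\Big)-\varphi\Big(\max\limits_{1\le i\le n}\|u+a_i-u_i\|\Big)}{\|(u_1-\omega_1,\ldots,u_n-\omega_n,u-x)\|_{\lambda,\eta}}<\varepsilon,$$ $$0<\max_{1\le i\le n}\|x+a_i-\omega_i\|\le\max_{1\le i\le n}\|a_i\|.$$ As a consequence, $$\limsup_{\substack{\Omega_i\ni u_i\to\omega_i\,(i=1,\ldots,n),\,u\to x\\(u_1,\ldots,u_n,u)\ne(\omega_1,\ldots,\omega_n,x)}}\frac{\varphi\Big(\max\limits_{1\le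 i\le n}\|x+a_i-\omega_i\|\Big)-\varphi\Big(\max\limits_{1\le i\le n}\|u+a_i-u_i\|\Big)}{\|(u_1-\omega_1,\ldots,u_n-\omega_n,u-x)\|_{\lambda,\eta}}<\varepsilon.$$ Moreover, if $\varphi$ is differentiable at $\max_{1\le i\le n}\|x+a_i-\omega_i\|$, then $$\varphi'\Big(\max_{1\le i\le n}\|x+a_i-\omega_i\|\Big)\cdot\limsup_{\substack{\Omega_i\ni u_i\to\omega_i\,(i=1,\ldots,n),\,u\to x\\(u_1,\ldots,u_n,u)\ne(\omega_1,\ldots,\omega_n,x)}}\frac{\max\limits_{1\le i\le n}\|x+a_i-\omega_i\|-\max\limits_{1\le i\le n}\|u+a_i-u_i\|}{\|(u_1-\omega_1,\ldots,u_n-\omega_n,u-x)\|_{\lambda,\eta}}<\varepsilon,$$ with the convention $0\cdot(+\infty)=0$.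
   Context: $\mathbb{B}_\delta(x)$ is the open ball with center $x$ and radius $\delta$ (with $\mathbb{B}_{+\infty}(x)=X$). $\mathcal{C}$ is the family of all continuous strictly increasing functions $\varphi:\mathbb{R}_+\to\mathbb{R}_+$ with $\varphi(0)=0$ and $\lim_{t\to+\infty}\varphi(t)=+\infty$. For subsets $S_1,\ldots,S_{m}$ of $X$ $(m\ge2)$, $$d(S_1,\ldots,S_m):=\inf_{u_i\in S_i\,(i=1,\ldots,m)}\ \max_{1\le i\le m-1}\|u_m-u_i\|$$ (used here with $m=n+1$). For $\lambda,\eta>0$, the norm $\|\cdot\|_{\lambda,\eta}$ on $X^{n+1}$ is $$\|(u_1,\ldots,u_n,u)\|_{\lambda,\eta}:=\max\{\lambda^{-1}\|u_1\|,\ldots,\lambda^{-1}\|u_{n}\|,\eta^{-1}\|u\|\}.$$ Convention: a supremum (or upper limit) over an empty set of admissible points is taken to be $0$. *)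

theory Defs
  imports "HOL-Analysis.Analysis"
begin

text \<open>Tuples \<open>(u\<^sub>1, \<dots>, u\<^sub>n)\<close> of vectors are elements of \<open>'a ^ 'n\<close> with \<open>n = CARD('n)\<close>; an element
  \<open>(u\<^sub>1, \<dots>, u\<^sub>n, u)\<close> of \<open>X\<^sup>n\<^sup>+\<^sup>1\<close> is a pair in \<open>('a ^ 'n) \<times> 'a\<close>, so that the convergence in the
  upper limits is the library's convergence in this product space.\<close>

definition open_ball :: "ereal \<Rightarrow> 'a::metric_space \<Rightarrow> 'a set" where
  "open_ball \<delta> x = {y. ereal (dist x y) < \<delta>}"

lemma open_ball_ereal: "open_ball (ereal r) x = ball x r"
  by (auto simp: open_ball_def)

lemma open_ball_PInfty: "open_ball \<infinity> x = UNIV"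
  by (auto simp: open_ball_def)

text \<open>A function \<open>\<real>\<^sub>+ \<rightarrow> \<real>\<^sub>+\<close> is represented by a function on the reals whose values at negative
  arguments are irrelevant.\<close>

definition class_C :: "(real \<Rightarrow> real) set" where
  "class_C = {\<phi>. \<phi> ` {0..} \<subseteq> {0..} \<and> continuous_on {0..} \<phi> \<and> strict_mono_on {0..} \<phi> \<and>
                 \<phi> 0 = 0 \<and> filterlim \<phi> at_top at_top}"

text \<open>The quantity \<open>d(S\<^sub>1, \<dots>, S\<^sub>n, T)\<close>. The infimum is a real one, so it is only meaningful when
  all the sets are nonempty.\<close>

definition sets_dist :: "('n::finite \<Rightarrow> 'a::real_normed_vector set) \<Rightarrow> 'a set \<Rightarrow> real" where
  "sets_dist S T = Inf {(MAX i. norm (v - u $ i)) | u v. (\<forall>i. u $ i \<in> S i) \<and> v \<in> T}"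

definition norm_weighted ::
    "real \<Rightarrow> real \<Rightarrow> ('a::real_normed_vector ^ 'n::finite) \<times> 'a \<Rightarrow> real" where
  "norm_weighted lam \<eta> = (\<lambda>(u, v). max (MAX i. inverse lam * norm (u $ i)) (inverse \<eta> * norm v))"

definition max_gap :: "('n::finite \<Rightarrow> 'a::real_normed_vector) \<Rightarrow> ('a ^ 'n) \<times> 'a \<Rightarrow> real" where
  "max_gap a = (\<lambda>(u, v). MAX i. norm (v + a i - u $ i))"

text \<open>Suprema and upper limits over an empty set of admissible points are \<open>0\<close> rather than
  \<open>- \<infinity>\<close>.\<close>

definition sup_over :: "'b set \<Rightarrow> ('b \<Rightarrow> real) \<Rightarrow> ereal" where
  "sup_over A f = (if A = {} then 0 else (SUP p\<in>A. ereal (f p)))"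

definition limsup_at :: "'b::topological_space \<Rightarrow> 'b set \<Rightarrow> ('b \<Rightarrow> real) \<Rightarrow> ereal" where
  "limsup_at q A f =
     (if at q within A = bot then 0 else Limsup (at q within A) (\<lambda>p. ereal (f p)))"

end

theory Submission
  imports Defs
begin

text \<open>Ekeland's variational principle is applied to \<open>\<phi> \<circ> max_gap a\<close> on
  \<open>\<Omega>\<^sub>1 \<times> \<dots> \<times> \<Omega>\<^sub>n \<times> cball xbar \<eta>\<close> with the distance \<open>\<epsilon>' \<parallel>\<cdot>\<parallel>\<^bsub>\<lambda>,\<eta>\<^esub>\<close>, where \<open>\<epsilon>' < \<epsilon>\<close> still bounds the gap
  between the value at \<open>(xbar, \<dots>, xbar)\<close> and the infimum. The point obtained is at weighted
  distance less than \<open>1\<close> from \<open>(xbar, \<dots>, xbar)\<close>, so it lies in the open balls. As \<open>max_gap a\<close> is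
  Lipschitz for the weighted norm, a first order expansion of \<open>\<phi>\<close> gives the statement about its
  derivative.\<close>

section \<open>Ekeland's variational principle\<close>

text \<open>Iterate over the sets \<open>T x\<close> of points that improve on \<open>x\<close> by
  at least their \<open>D\<close>-distance. Each step is chosen nearly optimal, so these nested sets
  shrink to a single point, which is the required \<open>z\<close>. Completeness and limits refer to
  the metric, which \<open>distD\<close> controls by \<open>D\<close>; lower semicontinuity of
  \<open>f\<close> takes the form of closed sublevel sets.\<close>

lemma ekeland:
  fixes S :: "'b::metric_space set" and D :: "'b \<Rightarrow> 'b \<Rightarrow> real"
  assumes S: "complete S" "x0 \<in> S"
    and lsc: "\<And>r. closed {y \<in> S. f y \<le> r}"
    and bdd: "\<And>y. y \<in> S \<Longrightarrow> m \<le> f y"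
    and D0: "\<And>x. D x x = 0"
    and tri: "\<And>x y z. D x z \<le> D x y + D y z"
    and contD: "\<And>x. continuous_on S (\<lambda>y. D y x)"
    and distD: "\<And>x y. dist x y \<le> C * D x y" and C: "C > 0"
  obtains z where "z \<in> S" "f z + D z x0 \<le> f x0"
    "\<And>y. y \<in> S \<Longrightarrow> y \<noteq> z \<Longrightarrow> f z < f y + D y z"
proof -
  have Dnn: "0 \<le> D x y" for x y
    using order_trans[OF zero_le_dist distD[of x y]] C by (simp add: zero_le_mult_iff)
  \<comment> \<open>The last claim about \<open>z\<close> says that \<open>T z\<close> contains no
    point other than \<open>z\<close>.\<close>
  define T where "T x = {y \<in> S. f y + D y x \<le> f x}" for x
  have T_self: "x \<in> T x" if "x \<in> S" for x
    using that D0 by (auto simp: T_def)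
  have T_mono: "T y \<subseteq> T x" if "y \<in> T x" for x y
  proof
    fix w assume "w \<in> T y"
    then show "w \<in> T x" using that tri[of w x y] by (simp add: T_def)
  qed
  \<comment> \<open>Some \<open>y\<close> brings \<open>f\<close> at least halfway from
    \<open>f x\<close> down to its infimum over \<open>T x\<close>. When \<open>f x\<close> already
    is that infimum, \<open>x\<close> itself serves; otherwise the midpoint lies strictly above the
    infimum and is undercut.\<close>
  have "\<exists>y \<in> T x. \<forall>w \<in> T x. 2 * f y \<le> f x + f w" if "x \<in> S" for x
  proof -
    let ?I = "Inf (f ` T x)"
    have bb: "bdd_below (f ` T x)"
      using bdd by (auto simp: T_def intro!: bdd_belowI2)
    have ne: "f ` T x \<noteq> {}" using T_self[OF that] by blast
    have low: "?I \<le> f w" if "w \<in> T x" for w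
      using bb that by (auto intro: cInf_lower)
    show ?thesis
    proof (cases "?I = f x")
      case True
      then have "2 * f x \<le> f x + f w" if "w \<in> T x" for w using low[OF that] by simp
      then show ?thesis using T_self[OF that] by blast
    next
      case False
      then have "?I < (?I + f x) / 2" using low[OF T_self[OF that]] by simp
      then obtain y where y: "y \<in> T x" "f y < (?I + f x) / 2"
        using cInf_lessD[OF ne] by blast
      then have "2 * f y \<le> f x + f w" if "w \<in> T x" for w using low[OF that] by simp
      then show ?thesis using y(1) by blast
    qed
  qed
  then have "\<forall>x\<in>S. \<exists>y. y \<in> T x \<and> (\<forall>w \<in> T x. 2 * f y \<le> f x + f w)"
    by blast
  from bchoice[OF this] obtain g where g: "\<And>x. x \<in> S \<Longrightarrow> g x \<in> T x"
      "\<And>x w. x \<in> S \<Longrightarrow> w \<in> T x \<Longrightarrow> 2 * f (g x) \<le> f x + f w"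
    by blast
  define X where "X n = (g ^^ n) x0" for n
  have XS: "X n \<in> S" for n
    by (induction n) (use S g(1) in \<open>auto simp: X_def T_def\<close>)
  have X_Suc: "X (Suc n) = g (X n)" for n by (simp add: X_def)
  have nested: "T (X n) \<subseteq> T (X k)" if "k \<le> n" for k n
    using that
  proof (induction rule: dec_induct)
    case (step n)
    have "X (Suc n) \<in> T (X n)" using g(1) XS X_Suc by simp
    then show ?case using T_mono step.IH by blast
  qed simp
  have XT: "X n \<in> T (X k)" if "k \<le> n" for k n
    using nested[OF that] T_self[OF XS] by blast
  have "decseq (\<lambda>n. f (X n))"
  proof (rule decseq_SucI)
    fix n show "f (X (Suc n)) \<le> f (X n)"
      using XT[of n "Suc n"] Dnn[of "X (Suc n)" "X n"] by (simp add: T_def)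
  qed
  then obtain L where L: "(\<lambda>n. f (X n)) \<longlonglongrightarrow> L" "\<And>n. L \<le> f (X n)"
    using decseq_convergent[of "\<lambda>n. f (X n)" m] bdd XS by blast
  \<comment> \<open>Membership gives \<open>D y (X (Suc n)) \<le> f (X (Suc n)) - f y\<close>. As
    \<open>y\<close> also lies in \<open>T (X n)\<close>, the halving property bounds the right-hand
    side by the last decrease of \<open>f\<close>. This makes the sets shrink, since these decreases
    tend to 0.\<close>
  have small: "D y (X (Suc n)) \<le> f (X n) - f (X (Suc n))" if "y \<in> T (X (Suc n))" for y n
  proof -
    have "y \<in> T (X n)" using that nested[of n "Suc n"] by auto
    then have "2 * f (X (Suc n)) \<le> f (X n) + f y" using g(2) XS X_Suc by simp
    then show ?thesis using that by (simp add: T_def)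
  qed
  have gap: "(\<lambda>n. C * (f (X n) - f (X (Suc n)))) \<longlonglongrightarrow> 0"
    using tendsto_mult[OF tendsto_const[of C] tendsto_diff[OF L(1) LIMSEQ_Suc[OF L(1)]]] by simp
  have near: "dist y (X (Suc n)) \<le> C * (f (X n) - f (X (Suc n)))" if "y \<in> T (X (Suc n))" for y n
    by (rule order_trans[OF distD]) (use small[OF that] C in auto)
  have "Cauchy X"
  proof (rule metric_CauchyI)
    fix e :: real assume "e > 0"
    then have "\<forall>\<^sub>F n in sequentially. C * (f (X n) - f (X (Suc n))) < e / 2"
      using order_tendstoD(2)[OF gap, of "e / 2"] by simp
    then obtain N where N: "C * (f (X N) - f (X (Suc N))) < e / 2"
      by (auto simp: eventually_sequentially)
    have "dist (X j) (X (Suc N)) < e / 2" if "j \<ge> Suc N" for j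
      using near[OF XT[OF that]] N by linarith
    then show "\<exists>M. \<forall>m\<ge>M. \<forall>n\<ge>M. dist (X m) (X n) < e"
      using dist_triangle_half_l by (metis dist_commute)
  qed
  then obtain z where z: "z \<in> S" "X \<longlonglongrightarrow> z"
    using S(1) XS unfolding complete_def by blast
  \<comment> \<open>The tail of \<open>X\<close> from \<open>j\<close> on stays in the closed
    sublevel set at height \<open>f (X j)\<close>, so its limit does too.\<close>
  have fz: "f z \<le> L"
  proof (rule LIMSEQ_le_const[OF L(1)], intro exI allI impI)
    fix j :: nat
    have "\<forall>\<^sub>F n in sequentially. X n \<in> {y \<in> S. f y \<le> f (X j)}"
      using XS \<open>decseq _\<close> by (auto simp: eventually_sequentially decseq_def)
    from Lim_in_closed_set[OF lsc this _ z(2)] show "f z \<le> f (X j)" by auto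
  qed
  \<comment> \<open>Pass to the limit in \<open>X n \<in> T (X k)\<close>: \<open>f (X n)\<close>
    tends to \<open>L\<close>, which is at least \<open>f z\<close>, and \<open>D\<close> is
    continuous in its first argument.\<close>
  have zT: "z \<in> T (X k)" for k
  proof -
    have "(\<lambda>n. D (X n) (X k)) \<longlonglongrightarrow> D z (X k)"
      using contD[of "X k"] z XS unfolding continuous_on_sequentially by (auto simp: o_def)
    moreover have "\<forall>\<^sub>F n in sequentially. f (X n) + D (X n) (X k) \<le> f (X k)"
      using XT by (auto simp: eventually_sequentially T_def)
    ultimately have "L + D z (X k) \<le> f (X k)"
      by (intro tendsto_upperbound[OF tendsto_add[OF L(1)]]) auto
    then show ?thesis using fz z(1) by (simp add: T_def)
  qed
  show ?thesis
  proof
    show "z \<in> S" by fact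
    show "f z + D z x0 \<le> f x0" using zT[of 0] by (simp add: T_def X_def)
    fix y assume y: "y \<in> S" "y \<noteq> z"
    show "f z < f y + D y z"
    \<comment> \<open>A violating \<open>y\<close> would lie in every \<open>T (X k)\<close>, so
      \<open>X\<close> would converge to \<open>y\<close> as well as to \<open>z\<close>.\<close>
    proof (rule ccontr)
      assume "\<not> ?thesis"
      then have "y \<in> T z" using y by (auto simp: T_def)
      then have "y \<in> T (X k)" for k using T_mono zT by blast
      then have "\<forall>n. dist (X (Suc n)) y \<le> C * (f (X n) - f (X (Suc n)))"
        using near by (simp add: dist_commute)
      then have "(\<lambda>n. dist (X (Suc n)) y) \<longlonglongrightarrow> 0"
        by (intro tendsto_sandwich[OF _ _ tendsto_const gap]) auto
      then have "(\<lambda>n. X (Suc n)) \<longlonglongrightarrow> y" using tendsto_dist_iff by blast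
      then show False using LIMSEQ_unique[OF LIMSEQ_Suc[OF z(2)]] y(2) by blast
    qed
  qed
qed

section \<open>The weighted norm and the gap function\<close>

lemma norm_weighted_le_iff:
  "norm_weighted l e p \<le> r \<longleftrightarrow>
    (\<forall>i. inverse l * norm (fst p $ i) \<le> r) \<and> inverse e * norm (snd p) \<le> r"
  by (cases p) (auto simp: norm_weighted_def)

lemma max_gap_le_iff: "max_gap a p \<le> r \<longleftrightarrow> (\<forall>i. norm (snd p + a i - fst p $ i) \<le> r)"
  by (cases p) (auto simp: max_gap_def)

lemma max_gap_ge: "norm (snd p + a i - fst p $ i) \<le> max_gap a p"
  using max_gap_le_iff[of a p "max_gap a p"] by simp

lemma max_gap_nonneg: "0 \<le> max_gap a p"
  by (rule order_trans[OF norm_ge_zero max_gap_ge])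

lemma norm_weighted_triangle:
  assumes "l > 0" "e > 0"
  shows "norm_weighted l e (p + q) \<le> norm_weighted l e p + norm_weighted l e q"
proof -
  have *: "(\<forall>i. inverse l * norm (fst p $ i) \<le> norm_weighted l e p) \<and>
      inverse e * norm (snd p) \<le> norm_weighted l e p" for p
    using norm_weighted_le_iff by blast
  have "inverse k * norm (x + y) \<le> r + s"
    if "inverse k * norm x \<le> r" "inverse k * norm y \<le> s" "k > 0" for x y :: 'a and k r s :: real
    using mult_left_mono[OF norm_triangle_ineq[of x y], of "inverse k"] that
    by (simp add: distrib_left)
  then show ?thesis
    unfolding norm_weighted_le_iff using *[of p] *[of q] assms by simp
qed

lemma norm_nth_le_norm_weighted:
  assumes "l > 0"
  shows "norm (fst p $ i) \<le> l * norm_weighted l e p"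
proof -
  have "inverse l * norm (fst p $ i) \<le> norm_weighted l e p"
    using norm_weighted_le_iff by blast
  then show ?thesis using assms by (simp add: field_simps)
qed

lemma norm_snd_le_norm_weighted:
  assumes "e > 0"
  shows "norm (snd p) \<le> e * norm_weighted l e p"
proof -
  have "inverse e * norm (snd p) \<le> norm_weighted l e p"
    using norm_weighted_le_iff by blast
  then show ?thesis using assms by (simp add: field_simps)
qed

lemma norm_weighted_minus_commute: "norm_weighted l e (p - q) = norm_weighted l e (q - p)"
  by (simp add: norm_weighted_def case_prod_beta norm_minus_commute)

lemma norm_weighted_le_norm:
  assumes "l > 0" "e > 0"
  shows "norm_weighted l e p \<le> (inverse l + inverse e) * norm p"
proof -
  have "norm (fst p $ i) \<le> norm p" for i
    using Finite_Cartesian_Product.norm_nth_le[of "fst p" i] norm_fst_le[of "fst p" "snd p"] by simp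
  moreover have "norm (snd p) \<le> norm p"
    using norm_snd_le[of "snd p" "fst p"] by simp
  ultimately show ?thesis
    unfolding norm_weighted_le_iff using assms
    by (auto intro!: mult_mono)
qed

text \<open>The product norm is at most the sum of the norms of all components, each bounded by its
  weight times the weighted norm. This supplies the constant that lets the weighted norm control the
  metric in Ekeland's principle.\<close>

lemma norm_le_norm_weighted:
  fixes p :: "('a::real_normed_vector ^ 'n::finite) \<times> 'a"
  assumes "l > 0" "e > 0"
  shows "norm p \<le> (real CARD('n) * l + e) * norm_weighted l e p"
proof -
  have "norm p \<le> norm (fst p) + norm (snd p)"
    using norm_Pair_le[of "fst p" "snd p"] by simp
  also have "norm (fst p) \<le> (\<Sum>i\<in>UNIV. norm (fst p $ i))"
    unfolding norm_vec_def by (rule L2_set_le_sum) simp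
  also have "\<dots> \<le> (\<Sum>i\<in>(UNIV::'n set). l * norm_weighted l e p)"
    by (intro sum_mono norm_nth_le_norm_weighted assms)
  also have "norm (snd p) \<le> e * norm_weighted l e p"
    by (rule norm_snd_le_norm_weighted) fact
  finally show ?thesis by (simp add: algebra_simps)
qed

lemma norm_weighted_pos:
  fixes p :: "('a::real_normed_vector ^ 'b::finite) \<times> 'a"
  assumes "l > 0" "e > 0" "p \<noteq> 0"
  shows "0 < norm_weighted l e p"
proof -
  have "0 < norm p" using assms(3) by simp
  also have "\<dots> \<le> (real CARD('b) * l + e) * norm_weighted l e p"
    by (rule norm_le_norm_weighted) fact+
  finally show ?thesis
    by (rule zero_less_mult_pos) (use assms(1,2) in \<open>simp add: add_nonneg_pos\<close>)
qed

text \<open>Each term of the maximum changes by at most the change of \<open>v\<close>, which costs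
  \<open>e\<close>, plus that of \<open>u $ i\<close>, which costs \<open>l\<close>. Exchanging
  \<open>p\<close> and \<open>q\<close> gives the absolute value.\<close>

lemma max_gap_lipschitz:
  assumes "l > 0" "e > 0"
  shows "\<bar>max_gap a p - max_gap a q\<bar> \<le> (l + e) * norm_weighted l e (p - q)"
proof -
  have "max_gap a p \<le> max_gap a q + (l + e) * norm_weighted l e (p - q)" for p q
    unfolding max_gap_le_iff
  proof
    fix i
    have "snd p + a i - fst p $ i =
        (snd q + a i - fst q $ i) + (snd (p - q) - fst (p - q) $ i)"
      by simp
    also have "norm \<dots> \<le> norm (snd q + a i - fst q $ i) + (norm (snd (p - q)) + norm (fst (p - q) $ i))"
      by (rule order_trans[OF norm_triangle_ineq add_left_mono[OF norm_triangle_ineq4]])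
    also have "\<dots> \<le> max_gap a q + (e * norm_weighted l e (p - q) + l * norm_weighted l e (p - q))"
      by (intro add_mono max_gap_ge norm_snd_le_norm_weighted norm_nth_le_norm_weighted assms)
    finally show "norm (snd p + a i - fst p $ i) \<le> max_gap a q + (l + e) * norm_weighted l e (p - q)"
      by (simp add: algebra_simps)
  qed
  from this[of p q] this[of q p] show ?thesis
    by (simp add: norm_weighted_minus_commute[of l e q p] abs_le_iff)
qed

lemma continuous_on_max_gap: "continuous_on A (max_gap a)"
proof (rule lipschitz_on_continuous_on, rule lipschitz_onI)
  fix p q
  have "\<bar>max_gap a p - max_gap a q\<bar> \<le> 2 * norm_weighted 1 1 (p - q)"
    using max_gap_lipschitz[of 1 1 a p q] by simp
  also have "\<dots> \<le> 4 * norm (p - q)"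
    using norm_weighted_le_norm[of 1 1 "p - q"] by simp
  finally show "dist (max_gap a p) (max_gap a q) \<le> 4 * dist p q"
    by (simp add: dist_norm)
qed simp

lemma continuous_on_norm_weighted_diff:
  assumes "l > 0" "e > 0"
  shows "continuous_on A (\<lambda>y. norm_weighted l e (y - x))"
proof (rule lipschitz_on_continuous_on, rule lipschitz_onI)
  fix p q
  have "\<bar>norm_weighted l e (p - x) - norm_weighted l e (q - x)\<bar> \<le> norm_weighted l e (p - q)"
    using norm_weighted_triangle[OF assms, of "p - q" "q - x"]
      norm_weighted_triangle[OF assms, of "q - p" "p - x"]
    by (simp add: norm_weighted_minus_commute[of l e q p] abs_le_iff)
  also have "\<dots> \<le> (inverse l + inverse e) * norm (p - q)"
    by (rule norm_weighted_le_norm) fact+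
  finally show "dist (norm_weighted l e (p - x)) (norm_weighted l e (q - x))
      \<le> (inverse l + inverse e) * dist p q"
    by (simp add: dist_norm)
qed (use assms in simp)

text \<open>For \<open>v\<close> in the open ball the gap is one of the values in the infimum, taken
  at the translates \<open>u $ i - a i\<close>. Continuity extends the bound to the closed ball, on
  which the minimisation takes place.\<close>

lemma sets_dist_le_max_gap:
  assumes \<Omega>: "\<And>i. u $ i \<in> \<Omega> i" and v: "v \<in> cball x r" and r: "r > 0"
  shows "sets_dist (\<lambda>i. (\<lambda>z. z - a i) ` \<Omega> i) (ball x r) \<le> max_gap a (u, v)" (is "?d \<le> _")
proof -
  have le: "?d \<le> max_gap a (u, w)" if "w \<in> ball x r" for w
    unfolding sets_dist_def
  proof (rule cInf_lower)
    show "max_gap a (u, w) \<in> {(MAX i. norm (v - u $ i)) | u v.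
        (\<forall>i. u $ i \<in> (\<lambda>z. z - a i) ` \<Omega> i) \<and> v \<in> ball x r}"
      using that \<Omega>
      by (intro CollectI exI[of _ "\<chi> i. u $ i - a i"] exI[of _ w])
        (auto simp: max_gap_def algebra_simps)
    show "bdd_below {(MAX i. norm (v - u $ i)) | u v.
        (\<forall>i. u $ i \<in> (\<lambda>z. z - a i) ` \<Omega> i) \<and> v \<in> ball x r}"
      by (rule bdd_belowI[of _ 0]) (auto simp: Max_ge_iff)
  qed
  have "continuous_on (closure (ball x r)) (\<lambda>w. max_gap a (u, w))"
    by (rule continuous_on_compose2[OF continuous_on_max_gap[of UNIV]])
      (auto intro!: continuous_intros)
  moreover have "v \<in> closure (ball x r)" using v r by simp
  ultimately show ?thesis
    by (rule continuous_ge_on_closure) (rule le)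
qed

section \<open>Existence of the points and the slope estimates\<close>

theorem theorem3p2:
  fixes \<Omega> :: "'n::finite \<Rightarrow> 'a::banach set"
    and xbar :: 'a
    and a :: "'n \<Rightarrow> 'a"
    and \<epsilon> lam \<eta> :: real
    and \<rho> :: ereal
    and \<phi> :: "real \<Rightarrow> real"
  assumes "CARD('n) \<ge> 2"
    and "\<And>i. closed (\<Omega> i)"
    and "xbar \<in> (\<Inter>i. \<Omega> i)"
    and "\<epsilon> > 0"
    and "\<rho> > 0"
    and "\<phi> \<in> class_C"
    and "(\<Inter>i. (\<lambda>z. z - a i) ` \<Omega> i) \<inter> open_ball \<rho> xbar = {}"
    and "lam > 0"
    and "0 < \<eta>" and "ereal \<eta> < \<rho>"
    and "\<phi> (MAX i. norm (a i)) <
           \<phi> (sets_dist (\<lambda>i. (\<lambda>z. z - a i) ` \<Omega> i) (ball xbar \<eta>)) + \<epsilon>"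
  shows "\<exists>(\<omega> :: 'a ^ 'n) (x :: 'a).
      (\<forall>i. \<omega> $ i \<in> \<Omega> i \<inter> ball xbar lam) \<and> x \<in> ball xbar \<eta> \<and>
      sup_over ({(u, v). (\<forall>i. u $ i \<in> \<Omega> i) \<and> v \<in> ball xbar \<eta>} - {(\<omega>, x)})
        (\<lambda>p. (\<phi> (max_gap a (\<omega>, x)) - \<phi> (max_gap a p)) / norm_weighted lam \<eta> (p - (\<omega>, x)))
        < ereal \<epsilon> \<and>
      0 < max_gap a (\<omega>, x) \<and> max_gap a (\<omega>, x) \<le> (MAX i. norm (a i)) \<and>
      limsup_at (\<omega>, x) {(u, v). \<forall>i. u $ i \<in> \<Omega> i}
        (\<lambda>p. (\<phi> (max_gap a (\<omega>, x)) - \<phi> (max_gap a p)) / norm_weighted lam \<eta> (p - (\<omega>, x)))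
        < ereal \<epsilon> \<and>
      (\<phi> differentiable (at (max_gap a (\<omega>, x))) \<longrightarrow>
        ereal (deriv \<phi> (max_gap a (\<omega>, x))) *
          limsup_at (\<omega>, x) {(u, v). \<forall>i. u $ i \<in> \<Omega> i}
            (\<lambda>p. (max_gap a (\<omega>, x) - max_gap a p) / norm_weighted lam \<eta> (p - (\<omega>, x)))
          < ereal \<epsilon>)"
proof -
  let ?N = "norm_weighted lam \<eta> :: ('a ^ 'n) \<times> 'a \<Rightarrow> real"
  let ?d = "sets_dist (\<lambda>i. (\<lambda>z. z - a i) ` \<Omega> i) (ball xbar \<eta>)"
  let ?A = "{(u, v). \<forall>i. u $ i \<in> \<Omega> i} :: (('a ^ 'n) \<times> 'a) set"
  let ?f = "\<lambda>p. \<phi> (max_gap a p)"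
  \<comment> \<open>The closed ball makes \<open>S\<close> closed, hence complete; the minimiser is
    shown later to lie in the open ball.\<close>
  define S where "S = ?A \<inter> {p. snd p \<in> cball xbar \<eta>}"
  define p0 :: "('a ^ 'n) \<times> 'a" where "p0 = ((\<chi> i. xbar), xbar)"
  note lam = \<open>lam > 0\<close> and \<eta> = \<open>0 < \<eta>\<close>
  have \<phi>: "\<phi> ` {0..} \<subseteq> {0..}" "continuous_on {0..} \<phi>" "strict_mono_on {0..} \<phi>"
    using \<open>\<phi> \<in> class_C\<close> by (auto simp: class_C_def)
  have \<phi>_le: "\<phi> s \<le> \<phi> t \<longleftrightarrow> s \<le> t" if "0 \<le> s" "0 \<le> t" for s t
    using \<phi>(3) that by (intro strict_mono_on_less_eq[of "{0..}"]) auto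
  have gap0: "max_gap a p0 = (MAX i. norm (a i))"
    by (simp add: max_gap_def p0_def)
  have "p0 \<in> S" using assms(3) \<eta> by (auto simp: S_def p0_def)
  have d0: "0 \<le> ?d"
    unfolding sets_dist_def
  proof (rule cInf_greatest)
    show "{(MAX i. norm (v - u $ i)) | (u::'a^'n) v.
        (\<forall>i. u $ i \<in> (\<lambda>z. z - a i) ` \<Omega> i) \<and> v \<in> ball xbar \<eta>} \<noteq> {}"
      using assms(3) \<eta> by (auto intro!: exI[of _ "\<chi> i. xbar - a i"] exI[of _ xbar])
  qed (auto simp: Max_ge_iff)
  have low: "\<phi> ?d \<le> ?f p" if "p \<in> S" for p
  proof -
    have "?d \<le> max_gap a p"
      using that sets_dist_le_max_gap[of "fst p" \<Omega> "snd p" xbar \<eta> a] \<eta>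
      by (auto simp: S_def)
    then show ?thesis using d0 \<phi>_le by (meson max_gap_nonneg)
  qed
  \<comment> \<open>The midpoint between \<epsilon> and the positive part of the excess of
    \<open>?f p0\<close> over the lower bound \<open>\<phi> ?d\<close>. This room below \<epsilon>
    turns the non-strict bounds on suprema and upper limits into strict ones.\<close>
  define \<epsilon>' where "\<epsilon>' = (\<epsilon> + max 0 (?f p0 - \<phi> ?d)) / 2"
  have \<epsilon>': "\<epsilon>' > 0" "\<epsilon>' < \<epsilon>" "?f p0 - \<phi> ?d < \<epsilon>'"
    using assms(11) \<open>\<epsilon> > 0\<close> unfolding \<epsilon>'_def gap0 by auto
  have closed: "closed S"
  proof -
    have "S = (\<Inter>i. (\<lambda>p. fst p $ i) -` \<Omega> i) \<inter> snd -` cball xbar \<eta>"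
      by (auto simp: S_def)
    moreover have "closed ((\<lambda>p::('a^'n)\<times>'a. fst p $ i) -` \<Omega> i)" for i
      by (rule closed_vimage[OF assms(2)]) (intro continuous_intros)
    moreover have "closed ((snd :: ('a^'n)\<times>'a \<Rightarrow> 'a) -` cball xbar \<eta>)"
      by (rule closed_vimage) (auto intro: continuous_intros)
    ultimately show ?thesis by auto
  qed
  have contf: "continuous_on S ?f"
    by (rule continuous_on_compose2[OF \<phi>(2) continuous_on_max_gap]) (auto simp: max_gap_nonneg)
  obtain q where q: "q \<in> S" "?f q + \<epsilon>' * ?N (q - p0) \<le> ?f p0"
    and min: "\<And>p. p \<in> S \<Longrightarrow> p \<noteq> q \<Longrightarrow> ?f q < ?f p + \<epsilon>' * ?N (p - q)"
  proof (rule ekeland[of S p0 ?f "\<phi> ?d" "\<lambda>p q. \<epsilon>' * ?N (p - q)"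
        "(real CARD('n) * lam + \<eta>) / \<epsilon>'"])
    show "complete S" using closed by (simp add: complete_eq_closed)
    show "closed {p \<in> S. ?f p \<le> r}" for r
      using continuous_closed_preimage[OF contf closed, of "{..r}"]
      by (simp add: vimage_def Int_def conj_commute)
    show "\<epsilon>' * ?N (x - x) = 0" for x
      by (simp add: norm_weighted_def zero_prod_def)
    show "\<epsilon>' * ?N (x - z) \<le> \<epsilon>' * ?N (x - y) + \<epsilon>' * ?N (y - z)" for x y z
      using mult_left_mono[OF norm_weighted_triangle[OF lam \<eta>, of "x - y" "y - z"], of \<epsilon>'] \<epsilon>'(1)
      by (simp add: distrib_left)
    show "continuous_on S (\<lambda>y. \<epsilon>' * ?N (y - x))" for x
      by (intro continuous_intros continuous_on_norm_weighted_diff lam \<eta>)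
    show "dist x y \<le> (real CARD('n) * lam + \<eta>) / \<epsilon>' * (\<epsilon>' * ?N (x - y))" for x y
      using norm_le_norm_weighted[OF lam \<eta>, of "x - y"] \<epsilon>'(1) by (simp add: dist_norm)
    show "0 < (real CARD('n) * lam + \<eta>) / \<epsilon>'"
      using lam \<eta> \<epsilon>'(1) by (simp add: add_nonneg_pos)
  qed (use \<open>p0 \<in> S\<close> low in auto)
  obtain \<omega> x where qx: "q = (\<omega>, x)" by (cases q)
  \<comment> \<open>The penalty is at most \<open>?f p0 - ?f q\<close>, hence at most
    \<open>?f p0 - \<phi> ?d\<close>, which is below \<open>\<epsilon>'\<close>.\<close>
  have "\<epsilon>' * ?N (q - p0) < \<epsilon>' * 1" using q low[OF q(1)] \<epsilon>'(3) by simp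
  then have N1: "?N (q - p0) < 1" using \<epsilon>'(1) by (simp only: mult_less_cancel_left_pos)
  have \<omega>: "\<omega> $ i \<in> \<Omega> i \<inter> ball xbar lam" for i
  proof -
    have "norm (\<omega> $ i - xbar) \<le> lam * ?N (q - p0)"
      using norm_nth_le_norm_weighted[OF lam, of "q - p0" i \<eta>] by (simp add: qx p0_def)
    also have "\<dots> < lam" using N1 lam by simp
    finally show ?thesis using q(1) by (simp add: S_def qx dist_norm norm_minus_commute)
  qed
  have x: "x \<in> ball xbar \<eta>"
  proof -
    have "norm (x - xbar) \<le> \<eta> * ?N (q - p0)"
      using norm_snd_le_norm_weighted[OF \<eta>, of "q - p0" lam] by (simp add: qx p0_def)
    also have "\<dots> < \<eta>" using N1 \<eta> by simp
    finally show ?thesis by (simp add: dist_norm norm_minus_commute)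
  qed
  have Npos: "0 < ?N (p - q)" if "p \<noteq> q" for p
    using norm_weighted_pos[OF lam \<eta>, of "p - q"] that by simp
  have quot: "(?f q - ?f p) / ?N (p - q) \<le> \<epsilon>'" if "p \<in> S" "p \<noteq> q" for p
    using min[OF that] Npos[OF that(2)] by (simp add: pos_divide_le_eq)
  have "0 \<le> \<epsilon>' * ?N (q - p0)"
  proof (cases "q = p0")
    case True
    then show ?thesis by (simp add: norm_weighted_def zero_prod_def)
  next
    case False
    then show ?thesis using norm_weighted_pos[OF lam \<eta>, of "q - p0"] \<epsilon>'(1) by simp
  qed
  then have gap_le: "max_gap a q \<le> (MAX i. norm (a i))"
    using q(2) \<phi>_le[OF max_gap_nonneg max_gap_nonneg, of a q a p0] gap0 by simp
  \<comment> \<open>A zero gap would make \<open>x\<close> equal to every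
    \<open>\<omega> $ i - a i\<close>, a common point of the translated sets inside the \<rho>-ball,
    as \<eta> is less than \<rho>.\<close>
  have gap_pos: "0 < max_gap a q"
  proof (rule ccontr)
    assume "\<not> ?thesis"
    then have "norm (x + a i - \<omega> $ i) \<le> 0" for i
      using max_gap_ge[of q a i] by (simp only: qx fst_conv snd_conv)
    then have "\<omega> $ i = x + a i" for i by simp
    then have "x \<in> (\<lambda>z. z - a i) ` \<Omega> i" for i
      using \<omega>[of i] by (intro image_eqI[of _ _ "\<omega> $ i"]) auto
    moreover have "x \<in> open_ball \<rho> xbar"
      using x assms(10) by (auto simp: open_ball_def intro: less_trans[of _ "ereal \<eta>"])
    ultimately show False using assms(7) by auto
  qed
  \<comment> \<open>Since \<open>x\<close> is in the open \<eta>-ball, the ball constraint holds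
    automatically near \<open>q\<close>, so minimality on \<open>S\<close> applies to the upper
    limits over \<open>?A\<close>.\<close>
  have near: "\<forall>\<^sub>F p in at q within ?A. p \<in> S \<and> p \<noteq> q"
  proof -
    have "open (snd -` ball xbar \<eta> :: (('a^'n)\<times>'a) set)"
      by (rule open_vimage_snd) simp
    then have "\<forall>\<^sub>F p in nhds q. p \<in> snd -` ball xbar \<eta>"
      by (rule eventually_nhds_in_open) (use x in \<open>simp add: qx\<close>)
    then have "\<forall>\<^sub>F p in at q within ?A. p \<in> snd -` ball xbar \<eta>"
      by (auto simp: eventually_at_filter elim: eventually_mono)
    moreover have "\<forall>\<^sub>F p in at q within ?A. p \<in> ?A \<and> p \<noteq> q"
      by (simp add: eventually_at_filter)
    ultimately show ?thesis
      by eventually_elim (auto simp: S_def)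
  qed
  \<comment> \<open>Nonnegativity of \<open>c\<close> covers the default value 0 when
    \<open>q\<close> is isolated in \<open>?A\<close>.\<close>
  have limsup_le: "limsup_at q ?A g \<le> ereal c"
    if "0 \<le> c" "\<forall>\<^sub>F p in at q within ?A. g p \<le> c" for g c
    using that by (auto simp: limsup_at_def intro!: Limsup_bounded)
  have C1: "sup_over ({(u, v). (\<forall>i. u $ i \<in> \<Omega> i) \<and> v \<in> ball xbar \<eta>} - {q})
        (\<lambda>p. (?f q - ?f p) / ?N (p - q)) < ereal \<epsilon>"
  proof -
    have "sup_over ({(u, v). (\<forall>i. u $ i \<in> \<Omega> i) \<and> v \<in> ball xbar \<eta>} - {q})
        (\<lambda>p. (?f q - ?f p) / ?N (p - q)) \<le> ereal \<epsilon>'"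
      using \<epsilon>'(1) by (auto simp: sup_over_def S_def intro!: SUP_least quot)
    also have "\<dots> < ereal \<epsilon>" using \<epsilon>'(2) by simp
    finally show ?thesis .
  qed
  have "limsup_at q ?A (\<lambda>p. (?f q - ?f p) / ?N (p - q)) \<le> ereal \<epsilon>'"
    by (rule limsup_le) (use \<epsilon>'(1) near quot in \<open>auto elim: eventually_mono\<close>)
  also have "\<dots> < ereal \<epsilon>" using \<epsilon>'(2) by simp
  finally have C2: "limsup_at q ?A (\<lambda>p. (?f q - ?f p) / ?N (p - q)) < ereal \<epsilon>" .
  have C3: "ereal (deriv \<phi> (max_gap a q)) *
      limsup_at q ?A (\<lambda>p. (max_gap a q - max_gap a p) / ?N (p - q)) < ereal \<epsilon>"
    if diff: "\<phi> differentiable (at (max_gap a q))"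
  proof -
    let ?t = "max_gap a q"
    define D where "D = deriv \<phi> ?t"
    have D: "(\<phi> has_real_derivative D) (at ?t)"
      using diff DERIV_deriv_iff_real_differentiable D_def by blast
    \<comment> \<open>Positivity of the gap puts \<open>?t\<close> in the interior of the half-line
      on which \<open>\<phi>\<close> is monotone.\<close>
    have "0 \<le> D"
      using mono_on_imp_deriv_nonneg[OF strict_mono_on_imp_mono_on[OF \<phi>(3)] D] gap_pos
      by (simp add: interior_real_atLeast)
    show ?thesis
    proof (cases "D = 0")
      \<comment> \<open>In \<open>ereal\<close> the product of 0 with any value, infinite ones
        included, is 0, as the convention demands.\<close>
      case True
      then show ?thesis using \<open>\<epsilon> > 0\<close> by (simp add: D_def[symmetric] flip: zero_ereal_def)
    next
      case False
      then have "D > 0" using \<open>0 \<le> D\<close> by simp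
      \<comment> \<open>The linearisation error is \<delta> times the change of the gap, hence at
        most \<open>\<delta> * (lam + \<eta>)\<close> times the weighted norm. This choice makes the
        total constant \<open>c\<close> the midpoint of \<open>\<epsilon>'\<close> and
        \<epsilon>.\<close>
      define \<delta> where "\<delta> = (\<epsilon> - \<epsilon>') / (2 * (lam + \<eta>))"
      have \<delta>: "\<delta> > 0" using \<epsilon>' lam \<eta> by (simp add: \<delta>_def)
      define c where "c = \<epsilon>' + \<delta> * (lam + \<eta>)"
      have "c = (\<epsilon> + \<epsilon>') / 2"
        using lam \<eta> by (simp add: c_def \<delta>_def add_pos_pos[THEN less_imp_neq, symmetric] field_simps)
      then have c: "0 < c" "c < \<epsilon>" using \<epsilon>' by auto
      have "\<forall>\<^sub>F s in nhds ?t. \<bar>\<phi> s - \<phi> ?t - D * (s - ?t)\<bar> \<le> \<delta> * \<bar>s - ?t\<bar>"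
        using D \<delta> unfolding has_field_derivative_def has_derivative_within_alt2
        by (auto simp: eventually_at_filter elim!: eventually_mono allE[of _ \<delta>])
      moreover have "(max_gap a \<longlongrightarrow> ?t) (at q within ?A)"
        using continuous_on_subset[OF continuous_on_max_gap[of UNIV a], of "insert q ?A"]
        by (auto simp: continuous_on_def intro: tendsto_within_subset)
      ultimately have "\<forall>\<^sub>F p in at q within ?A.
          \<bar>?f p - ?f q - D * (max_gap a p - ?t)\<bar> \<le> \<delta> * \<bar>max_gap a p - ?t\<bar>"
        by (rule eventually_compose_filterlim)
      with near have "\<forall>\<^sub>F p in at q within ?A. (?t - max_gap a p) / ?N (p - q) \<le> c / D"
      proof eventually_elim
        case (elim p)
        \<comment> \<open>Replace the linear term by the decrease of \<open>?f\<close> plus the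
          error; minimality of \<open>q\<close> bounds the former, the Lipschitz estimate the
          latter.\<close>
        have "D * (?t - max_gap a p) \<le> (?f q - ?f p) + \<delta> * \<bar>max_gap a p - ?t\<bar>"
          using elim(2) by (simp add: abs_le_iff algebra_simps)
        also have "\<dots> \<le> \<epsilon>' * ?N (p - q) + \<delta> * ((lam + \<eta>) * ?N (p - q))"
          using min[of p] elim(1) \<delta> max_gap_lipschitz[OF lam \<eta>, of a p q]
          by (intro add_mono mult_left_mono) auto
        also have "\<dots> = c * ?N (p - q)" by (simp add: c_def algebra_simps)
        finally show ?case using Npos[of p] elim(1) \<open>D > 0\<close>
          by (simp add: field_simps)
      qed
      then have "limsup_at q ?A (\<lambda>p. (?t - max_gap a p) / ?N (p - q)) \<le> ereal (c / D)"
        by (rule limsup_le[rotated]) (use c \<open>D > 0\<close> in simp)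
      then have "ereal D * limsup_at q ?A (\<lambda>p. (?t - max_gap a p) / ?N (p - q))
          \<le> ereal D * ereal (c / D)"
        using \<open>D > 0\<close> by (intro ereal_mult_left_mono) auto
      also have "\<dots> < ereal \<epsilon>" using c \<open>D > 0\<close> by simp
      finally show ?thesis by (simp add: D_def)
    qed
  qed
  show ?thesis
    using \<omega> x C1 C2 C3 gap_pos gap_le unfolding qx
    by (intro exI[of _ \<omega>] exI[of _ x]) blast
qed

end
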